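(* The orders $\mathbb{Z}[\sqrt{-3}]$ and $\mathbb{Z}[\sqrt{-7}]$ are PRINC domains.
   Context: Two elements $a,b$ of an integral domain $R$ form an idempotent pair if either $a(1-a)\in bR$ or $b(1-b)\in aR$. $R$ is a PRINC domain if every ideal of $R$ generated by an idempotent pair is principal. *)

theory Defs
  imports Complex_Main "HOL-Algebra.Ideal"
begin

definition idempotent_pair :: "('a, 'm) ring_scheme \<Rightarrow> 'a \<Rightarrow> 'a \<Rightarrow> bool" where
  "idempotent_pair R a b \<longleftrightarrow> a \<in> carrier R \<and> b \<in> carrier R \<and>
     (a \<otimes>\<^bsub>R\<^esub> (\<one>\<^bsub>R\<^esub> \<ominus>\<^bsub>R\<^esub> a) \<in> PIdl\<^bsub>R\<^esub> b \<or> b \<otimes>\<^bsub>R\<^esub> (\<one>\<^bsub>R\<^esub> \<ominus>\<^bsub>R\<^esub> b) \<in> PIdl\<^bsub>R\<^esub> a)"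

locale PRINC_domain = domain R for R (structure) +
  assumes idempotent_pair_principal:
    "idempotent_pair R a b \<Longrightarrow> principalideal (Idl {a, b}) R"

text \<open>The order \<open>\<int>[\<surd>d]\<close> as a subring of the complex numbers. For \<open>d < 0\<close> the
  principal square root \<open>csqrt d\<close> is \<open>\<i>\<surd>\<bar>d\<bar>\<close>; the other root gives the same set.\<close>

definition sqrt_order :: "int \<Rightarrow> complex ring" where
  "sqrt_order d = \<lparr>carrier = {of_int x + of_int y * csqrt (of_int d) | x y. True},
     mult = (*), one = 1, zero = 0, add = (+)\<rparr>"

end

theory Submission
  imports Defs
begin

text \<open>Let \<open>S = \<int>[\<surd>d]\<close> with \<open>d = -3\<close> or \<open>d = -7\<close>, let \<open>\<omega> = (1 + \<surd>d) / 2\<close>, and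
  let \<open>\<gamma>\<close> be an element of minimal modulus in a nonzero ideal \<open>I\<close>. Reducing elements of
  the fractional ideal \<open>\<gamma>\<^sup>-\<^sup>1 I\<close> modulo \<open>S\<close> shows that either \<open>I = \<gamma> S\<close> or
  \<open>\<omega> I \<subseteq> I\<close>. The second case is impossible for an ideal \<open>I = (a, b)\<close> with
  \<open>a (1 - a) = b c\<close>: since \<open>(a, b) (1 - a, b) = (b)\<close>, it would give \<open>\<omega> b \<in> b S\<close>
  and hence \<open>\<omega> \<in> S\<close>.\<close>

section \<open>The ring \<open>\<int>[\<surd>d]\<close> and its ideals\<close>

abbreviation quad_set :: "int \<Rightarrow> complex set" where
  "quad_set d \<equiv> carrier (sqrt_order d)"

text \<open>For d = -3 and d = -7 this is the usual generator of the full ring of integers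
  Z[\<omega>], which contains Z[sqrt d] with index 2.\<close>

definition half_root :: "int \<Rightarrow> complex" where
  "half_root d = (1 + csqrt (of_int d)) / 2"

lemma quad_set_iff:
  "z \<in> quad_set d \<longleftrightarrow> (\<exists>x y. z = of_int x + of_int y * csqrt (of_int d))"
  by (simp add: sqrt_order_def)

lemma sqrt_order_simps [simp]:
  "mult (sqrt_order d) = (*)" "one (sqrt_order d) = 1"
  "zero (sqrt_order d) = 0" "add (sqrt_order d) = (+)"
  by (simp_all add: sqrt_order_def)

lemma csqrt_sq: "csqrt (of_int d) * csqrt (of_int d) = of_int d"
  using power2_csqrt[of "of_int d"] by (simp only: power2_eq_square)

lemma quad_setI: "of_int x + of_int y * csqrt (of_int d) \<in> quad_set d"
  by (auto simp: quad_set_iff)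

lemma quad_of_int [intro, simp]: "of_int x \<in> quad_set d"
  using quad_setI[of x 0 d] by simp

lemma quad_0 [intro, simp]: "0 \<in> quad_set d"
  using quad_of_int[of 0] by simp

lemma quad_1 [intro, simp]: "1 \<in> quad_set d"
  using quad_of_int[of 1] by simp

lemma quad_csqrt [intro, simp]: "csqrt (of_int d) \<in> quad_set d"
  using quad_setI[of 0 1 d] by simp

lemma quad_add [intro]:
  assumes "x \<in> quad_set d" "y \<in> quad_set d" shows "x + y \<in> quad_set d"
proof -
  obtain a b e f where "x = of_int a + of_int b * csqrt (of_int d)"
    "y = of_int e + of_int f * csqrt (of_int d)"
    using assms unfolding quad_set_iff by blast
  then have "x + y = of_int (a + e) + of_int (b + f) * csqrt (of_int d)"
    by (simp add: algebra_simps)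
  then show ?thesis using quad_setI by metis
qed

lemma quad_mult [intro]:
  assumes "x \<in> quad_set d" "y \<in> quad_set d" shows "x * y \<in> quad_set d"
proof -
  obtain a b e f where xy: "x = of_int a + of_int b * csqrt (of_int d)"
    "y = of_int e + of_int f * csqrt (of_int d)"
    using assms unfolding quad_set_iff by blast
  have "x * y = of_int a * of_int e + of_int b * of_int f * (csqrt (of_int d) * csqrt (of_int d))
      + (of_int a * of_int f + of_int b * of_int e) * csqrt (of_int d)"
    unfolding xy by (simp only: algebra_simps)
  also have "\<dots> = of_int (a * e + b * f * d) + of_int (a * f + b * e) * csqrt (of_int d)"
    by (simp add: csqrt_sq)
  finally show ?thesis using quad_setI by metis
qed

lemma quad_uminus [intro]: "x \<in> quad_set d \<Longrightarrow> - x \<in> quad_set d"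
  using quad_mult[OF quad_of_int[of "-1"], of x d] by simp

lemma quad_diff [intro]: "x \<in> quad_set d \<Longrightarrow> y \<in> quad_set d \<Longrightarrow> x - y \<in> quad_set d"
  using quad_add[of x d "- y"] by auto

section \<open>Ring structure and ideals, expressed by complex arithmetic\<close>

lemma domain_sqrt_order: "domain (sqrt_order d)"
proof (intro domain.intro domain_axioms.intro cringI)
  show "abelian_group (sqrt_order d)"
  proof (rule abelian_groupI)
    fix x assume "x \<in> quad_set d"
    then show "\<exists>y\<in>quad_set d. add (sqrt_order d) y x = zero (sqrt_order d)"
      by (intro bexI[of _ "- x"]) auto
  qed auto
  show "comm_monoid (sqrt_order d)"
    by (rule comm_monoidI) auto
qed (auto simp: algebra_simps)

text \<open>Closure under additive inverses comes from multiplication by -1, a ring element. Later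
  arguments about ideals can thus be carried out on subsets of the complex numbers.\<close>

lemma ideal_sqrt_order_iff:
  "ideal I (sqrt_order d) \<longleftrightarrow> I \<subseteq> quad_set d \<and> 0 \<in> I \<and> (\<forall>x\<in>I. \<forall>y\<in>I. x + y \<in> I) \<and>
     (\<forall>x\<in>I. \<forall>r\<in>quad_set d. r * x \<in> I)"
    (is "?l \<longleftrightarrow> ?r")
proof
  interpret R: "domain" "sqrt_order d" by (rule domain_sqrt_order)
  {
    assume ?l
    then interpret I: ideal I "sqrt_order d" .
    show ?r
      using I.a_subset I.zero_closed I.a_closed I.I_l_closed by auto
  }
  assume r: ?r
  show ?l
  proof (rule idealI)
    have neg: "- x \<in> I" if "x \<in> I" for x
    proof -
      have "of_int (-1) * x \<in> I" using r that quad_of_int by blast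
      then show ?thesis by simp
    qed
    have inv: "a_inv (sqrt_order d) x = - x" if "x \<in> quad_set d" for x
      using R.minus_equality[of "- x" x] that by auto
    show "subgroup I (add_monoid (sqrt_order d))"
    proof (rule R.add.subgroupI)
      show "a_inv (sqrt_order d) x \<in> I" if "x \<in> I" for x
        using neg[OF that] inv[of x] r that by auto
    qed (use r in auto)
  qed (use r R.ring_axioms in \<open>auto simp: mult.commute\<close>)
qed

lemma minus_sqrt_order:
  assumes "x \<in> quad_set d" "y \<in> quad_set d"
  shows "a_minus (sqrt_order d) x y = x - y"
proof -
  interpret R: "domain" "sqrt_order d" by (rule domain_sqrt_order)
  have "a_inv (sqrt_order d) y = - y"
    using R.minus_equality[of "- y" y] assms by auto
  then show ?thesis by (simp add: a_minus_def)
qed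

lemma genideal_pair_sqrt_order:
  assumes "a \<in> quad_set d" "b \<in> quad_set d"
  shows "genideal (sqrt_order d) {a, b} = {u * a + v * b | u v. u \<in> quad_set d \<and> v \<in> quad_set d}"
    (is "_ = ?I")
proof
  interpret R: "domain" "sqrt_order d" by (rule domain_sqrt_order)
  have "ideal ?I (sqrt_order d)"
    unfolding ideal_sqrt_order_iff
  proof (intro conjI ballI subsetI)
    have "0 = 0 * a + 0 * b" by simp
    then show "0 \<in> ?I" using quad_0 by blast
    fix x assume "x \<in> ?I"
    then obtain u v where x: "x = u * a + v * b" and uv: "u \<in> quad_set d" "v \<in> quad_set d"
      by blast
    show "x \<in> quad_set d" using x uv assms by auto
    show "r * x \<in> ?I" if "r \<in> quad_set d" for r
    proof -
      have "r * x = (r * u) * a + (r * v) * b" by (simp add: x algebra_simps)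
      then show ?thesis using that uv by blast
    qed
    fix y assume "y \<in> ?I"
    then obtain u' v' where y: "y = u' * a + v' * b" and uv': "u' \<in> quad_set d" "v' \<in> quad_set d"
      by blast
    have "x + y = (u + u') * a + (v + v') * b" by (simp add: x y algebra_simps)
    then show "x + y \<in> ?I" using uv uv' by blast
  qed
  moreover have "a = 1 * a + 0 * b" "b = 0 * a + 1 * b" by auto
  then have "{a, b} \<subseteq> ?I" using quad_0 quad_1 by blast
  ultimately show "genideal (sqrt_order d) {a, b} \<subseteq> ?I" by (rule R.genideal_minimal)
  have id: "ideal (genideal (sqrt_order d) {a, b}) (sqrt_order d)"
    using assms by (intro R.genideal_ideal) auto
  have "{a, b} \<subseteq> genideal (sqrt_order d) {a, b}"
    using assms by (intro R.genideal_self) auto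
  with id show "?I \<subseteq> genideal (sqrt_order d) {a, b}"
    unfolding ideal_sqrt_order_iff by auto
qed

lemma principalideal_sqrt_orderI:
  assumes "g \<in> quad_set d" "I = {r * g | r. r \<in> quad_set d}"
  shows "principalideal I (sqrt_order d)"
proof -
  interpret R: "domain" "sqrt_order d" by (rule domain_sqrt_order)
  have "I = cgenideal (sqrt_order d) g"
    using assms(2) by (simp add: cgenideal_def)
  then show ?thesis using R.cgenideal_is_principalideal[OF assms(1)] by simp
qed

section \<open>Reduction modulo \<open>\<int>[\<surd>d]\<close>\<close>

lemma Re_Im_csqrt_neg:
  assumes "d < 0"
  shows "Re (csqrt (of_int d)) = 0" "Im (csqrt (of_int d)) = sqrt (- of_int d)"
proof -
  have "csqrt (of_int d) = \<i> * sqrt \<bar>of_int d\<bar>"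
    using assms csqrt_of_real_nonpos[of "of_int d"] by simp
  then show "Re (csqrt (of_int d)) = 0" "Im (csqrt (of_int d)) = sqrt (- of_int d)"
    using assms by auto
qed

text \<open>The norm form with real coefficients, so that it covers both ring elements and arbitrary
  points of a fractional ideal.\<close>

lemma cmod_quad_sq:
  assumes "d < 0"
  shows "(cmod (of_real x + of_real y * csqrt (of_int d)))\<^sup>2 = x\<^sup>2 - of_int d * y\<^sup>2"
  using assms Re_Im_csqrt_neg[OF assms]
  by (simp add: cmod_power2 power_mult_distrib del: csqrt.simps)

text \<open>Since sqrt d is purely imaginary, ring elements have integral real part, whereas
  \<omega> has real part 1/2.\<close>

lemma half_root_not_in_quad_set:
  assumes "d < 0" shows "half_root d \<notin> quad_set d"
proof
  assume "half_root d \<in> quad_set d"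
  then obtain x y :: int where "half_root d = of_int x + of_int y * csqrt (of_int d)"
    unfolding quad_set_iff by blast
  then have "Re (half_root d) = of_int x"
    using Re_Im_csqrt_neg[OF assms] by (simp del: csqrt.simps)
  moreover have "Re (half_root d) = 1 / 2"
    using Re_Im_csqrt_neg[OF assms] by (simp add: half_root_def del: csqrt.simps)
  ultimately have "2 * of_int x = (1::real)" by simp
  then have "of_int (2 * x) = (of_int 1 :: real)" by simp
  then have "2 * x = 1" by (simp only: of_int_eq_iff)
  then show False by presburger
qed

text \<open>On the box the form is at most x/2 + 3y/2, which reaches 1 only at the corner (1/2,
  1/2).\<close>

lemma reduced_point_3:
  fixes x y :: real
  assumes "0 \<le> x" "x \<le> 1/2" "0 \<le> y" "y \<le> 1/2" "x\<^sup>2 + 3 * y\<^sup>2 \<ge> 1"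
  shows "x = 1/2 \<and> y = 1/2"
proof -
  have "x\<^sup>2 \<le> x/2" "y\<^sup>2 \<le> y/2"
    using mult_left_mono[of x "1/2" x] mult_left_mono[of y "1/2" y] assms
    by (auto simp: power2_eq_square)
  then show ?thesis using assms by linarith
qed

lemma parabola_lower_bound:
  fixes c v :: real
  assumes "c \<le> v" "v \<le> 1 - c"
  shows "c - c\<^sup>2 \<le> v - v\<^sup>2"
proof -
  have "0 \<le> (v - c) * (1 - c - v)" using assms by (intro mult_nonneg_nonneg) auto
  then show ?thesis by (simp add: power2_eq_square algebra_simps)
qed

text \<open>With t = x + y sqrt(-7), the hypotheses keep t out of the open disc of radius 1 about 0
  and, except for their centres, out of the open discs of radius 1/2 about (1 + sqrt(-7))/2 and
  sqrt(-7)/2. These three discs cover the whole rectangle, so only the last two centres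
  remain.\<close>

lemma reduced_point_7:
  fixes x y :: real
  assumes "0 \<le> x" "x \<le> 1/2" "0 \<le> y" "y \<le> 1/2"
    and A: "x\<^sup>2 + 7 * y\<^sup>2 \<ge> 1"
    and B: "(2*x - 1)\<^sup>2 + 7 * (2*y - 1)\<^sup>2 \<ge> 1 \<or> x = 1/2 \<and> y = 1/2"
    and C: "(2*x)\<^sup>2 + 7 * (2*y - 1)\<^sup>2 \<ge> 1 \<or> x = 0 \<and> y = 1/2"
  shows "y = 1/2 \<and> (x = 0 \<or> x = 1/2)"
proof (rule ccontr)
  assume n: "\<not> ?thesis"
  \<comment> \<open>Offsets from the corner (1/2, 1/2). The covering is tightest near x = 1/2, that
    is for small u, hence the decimal bounds below.\<close>
  define u v where "u = 1/2 - x" and "v = 1/2 - y"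
  have x: "x = 1/2 - u" "y = 1/2 - v" by (auto simp: u_def v_def)
  have uv: "0 \<le> u" "u \<le> 1/2" "0 \<le> v" "v \<le> 1/2" using assms x by auto
  have A': "u - u\<^sup>2 + 7 * v - 7 * v\<^sup>2 \<le> 1"
    using A unfolding x by (simp add: power2_eq_square algebra_simps)
  have B': "4 * u\<^sup>2 + 28 * v\<^sup>2 \<ge> 1"
    using B n unfolding x by (auto simp: power2_eq_square algebra_simps)
  have C': "4 * x\<^sup>2 + 28 * v\<^sup>2 \<ge> 1"
    using C n unfolding x by (auto simp: power2_eq_square algebra_simps)
  have uu: "u\<^sup>2 \<le> u/2" "x\<^sup>2 \<le> x/2"
    using mult_left_mono[of u "1/2" u] mult_left_mono[of x "1/2" x] uv assms
    by (auto simp: power2_eq_square)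
  \<comment> \<open>A rational just below sqrt(3/112), which is about 0.1637.\<close>
  have v163: "v > 163/1000" if "28 * v\<^sup>2 \<ge> 3/4"
  proof (rule ccontr)
    assume "\<not> ?thesis"
    then have "v\<^sup>2 \<le> (163/1000)\<^sup>2" using uv by (intro power_mono) auto
    then show False using that by (simp add: power2_eq_square)
  qed
  have v_v2: "v - v\<^sup>2 \<ge> 136/1000" if "v > 163/1000"
  proof -
    have "(163/1000) - (163/1000)\<^sup>2 \<le> v - v\<^sup>2"
      using uv that by (intro parabola_lower_bound) auto
    then show ?thesis by (simp add: power2_eq_square)
  qed
  show False
  proof (cases "u \<le> 1/4")
    case True
    have u4: "u\<^sup>2 \<le> u/4" using mult_left_mono[OF True, of u] uv by (simp add: power2_eq_square)
    then have v1: "v - v\<^sup>2 \<ge> 136/1000" using v163 v_v2 B' True by linarith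
    \<comment> \<open>The first bound gives only 7 * 0.136 = 0.952 < 1, no contradiction yet. It
      forces u to be small, and putting this back into \<open>B'\<close> improves the bound on v
      until 7 * 0.147 > 1.\<close>
    have "u \<le> 7/100" using A' v1 u4 by linarith
    then have "28 * v\<^sup>2 \<ge> 93/100" using B' u4 by linarith
    have "v > 18/100"
    proof (rule ccontr)
      assume "\<not> ?thesis"
      then have "v\<^sup>2 \<le> (18/100)\<^sup>2" using uv by (intro power_mono) auto
      then show False using \<open>28 * v\<^sup>2 \<ge> 93/100\<close> by (simp add: power2_eq_square)
    qed
    then have "(18/100) - (18/100)\<^sup>2 \<le> v - v\<^sup>2"
      using uv by (intro parabola_lower_bound) auto
    then have "v - v\<^sup>2 \<ge> 147/1000" by (simp add: power2_eq_square)
    then show False using A' uu uv by linarith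
  next
    case False
    then have "x \<le> 1/4" using x by auto
    then have "x\<^sup>2 \<le> x/4" using mult_left_mono[of x "1/4" x] assms by (simp add: power2_eq_square)
    \<comment> \<open>Away from the tight region one pass is enough: 7 * 0.136 + 3/16 > 1.\<close>
    then have "v - v\<^sup>2 \<ge> 136/1000" using v163 v_v2 C' \<open>x \<le> 1/4\<close> by linarith
    moreover have "u - u\<^sup>2 \<ge> 3/16"
      using parabola_lower_bound[of "1/4" u] False uv by (simp add: power2_eq_square)
    ultimately show False using A' by linarith
  qed
qed

text \<open>Rounding to a nearest integer, with the sign of the remainder split off, so that only
  one quadrant of reduced points has to be studied.\<close>

lemma reduced_representation:
  obtains x :: real and m \<sigma> :: int
  where "z = of_int m + of_int \<sigma> * x" "0 \<le> x" "x \<le> 1/2" "\<sigma> = 1 \<or> \<sigma> = -1"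
proof -
  have r: "\<bar>z - of_int (round z)\<bar> \<le> 1/2"
    using of_int_round_abs_le[of z] by (simp add: abs_minus_commute)
  show ?thesis
  proof (cases "z \<ge> of_int (round z)")
    case True
    then show ?thesis using r by (intro that[of "round z" 1 "z - of_int (round z)"]) auto
  next
    case False
    then show ?thesis using r by (intro that[of "round z" "-1" "of_int (round z) - z"]) auto
  qed
qed

lemma quad_representation:
  assumes "d < 0"
  obtains x y :: real where "z = of_real x + of_real y * csqrt (of_int d)"
proof
  show "z = of_real (Re z) + of_real (Im z / sqrt (- of_int d)) * csqrt (of_int d)"
    using assms Re_Im_csqrt_neg[OF assms] by (simp add: complex_eq_iff del: csqrt.simps)
qed

text \<open>\<open>H\<close> models the fractional ideal I / g for g of minimal modulus among the
  nonzero elements of I: \<open>one\<close> says that g lies in I, and \<open>minimal\<close> is the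
  choice of g.\<close>

locale reduced_module =
  fixes d :: int and H :: "complex set"
  assumes d: "d = -3 \<or> d = -7"
    and one: "1 \<in> H"
    and add: "x \<in> H \<Longrightarrow> y \<in> H \<Longrightarrow> x + y \<in> H"
    and smult: "x \<in> H \<Longrightarrow> r \<in> quad_set d \<Longrightarrow> r * x \<in> H"
    and minimal: "x \<in> H \<Longrightarrow> x \<noteq> 0 \<Longrightarrow> 1 \<le> cmod x"
begin

lemma d_neg: "d < 0" using d by auto

lemma quad_subset: "quad_set d \<subseteq> H"
  using smult[OF one] by auto

lemma diff_quad: "x \<in> H \<Longrightarrow> r \<in> quad_set d \<Longrightarrow> x - r \<in> H"
  using add[of x "- r"] quad_subset quad_uminus by auto

lemma norm_lower:
  assumes "of_real x + of_real y * csqrt (of_int d) \<in> H"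
  shows "x\<^sup>2 - of_int d * y\<^sup>2 \<ge> 1 \<or> x = 0 \<and> y = 0"
proof (cases "of_real x + of_real y * csqrt (of_int d) = 0")
  case True
  then have "x\<^sup>2 + (- of_int d * y\<^sup>2) = 0" using cmod_quad_sq[OF d_neg, of x y] by simp
  moreover have "- of_int d * y\<^sup>2 \<ge> 0" using d by auto
  ultimately have "x\<^sup>2 = 0" "- of_int d * y\<^sup>2 = 0"
    by (metis add_nonneg_eq_0_iff zero_le_power2)+
  then show ?thesis using d_neg by auto
next
  case False
  then have "1 \<le> cmod (of_real x + of_real y * csqrt (of_int d))" using minimal assms by blast
  then have "1\<^sup>2 \<le> (cmod (of_real x + of_real y * csqrt (of_int d)))\<^sup>2" by (intro power_mono) auto
  then show ?thesis using cmod_quad_sq[OF d_neg, of x y] by simp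
qed

text \<open>Subtracting a nearest lattice point p from q leaves t with reduced coordinates.
  Minimality is then applied to t and to two translates of 2t by ring elements, which forces t to be
  0 or (\<plusminus>1 \<plusminus> sqrt d)/2.\<close>

lemma quad_or_half_root:
  assumes q: "q \<in> H"
  shows "q \<in> quad_set d \<or> q - half_root d \<in> quad_set d"
proof -
  let ?s = "csqrt (of_int d)"
  obtain X Y :: real where XY: "q = of_real X + of_real Y * ?s"
    using quad_representation[OF d_neg] .
  obtain x and m \<sigma> :: int where X: "X = of_int m + of_int \<sigma> * x" "0 \<le> x" "x \<le> 1/2"
    and \<sigma>: "\<sigma> = 1 \<or> \<sigma> = -1" by (rule reduced_representation)
  obtain y and n \<tau> :: int where Y: "Y = of_int n + of_int \<tau> * y" "0 \<le> y" "y \<le> 1/2"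
    and \<tau>: "\<tau> = 1 \<or> \<tau> = -1" by (rule reduced_representation)
  define p where "p = of_int m + of_int n * ?s"
  have p: "p \<in> quad_set d" unfolding p_def by (rule quad_setI)
  define t where "t = of_real (of_int \<sigma> * x) + of_real (of_int \<tau> * y) * ?s"
  have q_eq: "q = p + t" unfolding XY X(1) Y(1) p_def t_def by (simp add: algebra_simps)
  have t: "t \<in> H" using diff_quad[OF q p] q_eq by simp
  have sq: "(of_int \<sigma> * z)\<^sup>2 = z\<^sup>2" "(of_int \<tau> * z)\<^sup>2 = z\<^sup>2" for z :: real
    using \<sigma> \<tau> by auto
  have A: "x\<^sup>2 - of_int d * y\<^sup>2 \<ge> 1 \<or> x = 0 \<and> y = 0"
    using norm_lower[of "of_int \<sigma> * x" "of_int \<tau> * y"] t \<sigma> \<tau> unfolding t_def sq by auto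
  have t2: "2 * t \<in> H" using add[OF t t] by simp
  \<comment> \<open>Translating by the signs themselves brings 2t close to 0 when (x, y) is near
    (1/2, 1/2); the translate for \<open>C\<close> does the same near (0, 1/2).\<close>
  have "of_real (of_int \<sigma> * (2 * x - 1)) + of_real (of_int \<tau> * (2 * y - 1)) * ?s
      = 2 * t - (of_int \<sigma> + of_int \<tau> * ?s)"
    by (simp add: t_def algebra_simps)
  then have B: "(2*x - 1)\<^sup>2 - of_int d * (2*y - 1)\<^sup>2 \<ge> 1 \<or> 2*x - 1 = 0 \<and> 2*y - 1 = 0"
    using norm_lower[of "of_int \<sigma> * (2*x - 1)" "of_int \<tau> * (2*y - 1)"]
      diff_quad[OF t2 quad_setI[of \<sigma> \<tau>]] \<sigma> \<tau> unfolding sq by auto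
  have "of_real (2 * (of_int \<sigma> * x)) + of_real (of_int \<tau> * (2 * y - 1)) * ?s
      = 2 * t - (of_int 0 + of_int \<tau> * ?s)"
    by (simp add: t_def algebra_simps)
  then have C: "(2*x)\<^sup>2 - of_int d * (2*y - 1)\<^sup>2 \<ge> 1 \<or> 2*x = 0 \<and> 2*y - 1 = 0"
    using norm_lower[of "2 * (of_int \<sigma> * x)" "of_int \<tau> * (2*y - 1)"]
      diff_quad[OF t2 quad_setI[of 0 \<tau>]] \<sigma> \<tau> unfolding power_mult_distrib sq by auto
  \<comment> \<open>Here t would be \<plusminus>sqrt(-7)/2. Then sqrt(-7) t = -7\<tau>/2, and adding
    4\<tau> gives the element \<tau>/2 of \<open>H\<close>, whose modulus 1/2 is too small.\<close>
  have E: "\<not> (x = 0 \<and> y = 1/2)" if "d = -7"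
  proof
    assume "x = 0 \<and> y = 1/2"
    then have "x = 0" "y = 1/2" by auto
    have "t = of_real (of_int \<tau> / 2) * ?s" 
      unfolding t_def \<open>x = 0\<close> \<open>y = 1/2\<close> by simp
    then have "?s * t = of_real (of_int \<tau> / 2) * (?s * ?s)" by (simp only: ac_simps)
    also have "\<dots> = of_real (- (7 * of_int \<tau> / 2))" unfolding csqrt_sq that by simp
    finally have "?s * t - of_int (- (4 * \<tau>))
        = of_real (of_int \<tau> / 2) + of_real 0 * ?s" by simp
    then have "of_real (of_int \<tau> / 2) + of_real 0 * ?s \<in> H"
      using diff_quad[OF smult[OF t quad_csqrt] quad_of_int[of "- (4 * \<tau>)"]] by metis
    from norm_lower[OF this] show False using \<tau> by (auto simp: power2_eq_square)
  qed
  have "x = 0 \<and> y = 0 \<or> x = 1/2 \<and> y = 1/2"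
  proof (cases "x = 0 \<and> y = 0")
    case False
    show ?thesis
    proof (cases "d = -3")
      case True
      then show ?thesis using reduced_point_3[of x y] X Y A False by auto
    next
      case False': False
      then have "d = -7" using d by blast
      have "y = 1/2 \<and> (x = 0 \<or> x = 1/2)"
      proof (rule reduced_point_7)
        show "x\<^sup>2 + 7 * y\<^sup>2 \<ge> 1" using A False \<open>d = -7\<close> by simp
        show "(2*x - 1)\<^sup>2 + 7 * (2*y - 1)\<^sup>2 \<ge> 1 \<or> x = 1/2 \<and> y = 1/2"
          using B \<open>d = -7\<close> by auto
        show "(2*x)\<^sup>2 + 7 * (2*y - 1)\<^sup>2 \<ge> 1 \<or> x = 0 \<and> y = 1/2"
          using C \<open>d = -7\<close> by auto
      qed (fact X Y)+
      then show ?thesis using E[OF \<open>d = -7\<close>] by blast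
    qed
  qed auto
  then show ?thesis
  proof
    assume "x = 0 \<and> y = 0"
    then show ?thesis using q_eq p by (simp add: t_def)
  next
    assume "x = 1/2 \<and> y = 1/2"
    then have xy: "x = 1/2" "y = 1/2" by auto
    \<comment> \<open>Both signs are odd, so all four points (\<plusminus>1 \<plusminus> sqrt d)/2
      are congruent to \<omega> modulo the ring.\<close>
    obtain k l :: int where kl: "\<sigma> = 2 * k + 1" "\<tau> = 2 * l + 1"
      using \<sigma> \<tau> that[of "\<sigma> div 2" "\<tau> div 2"] by auto
    have "q - half_root d = p + (of_int k + of_int l * ?s)"
      unfolding q_eq t_def half_root_def kl xy by (simp add: field_simps)
    then show ?thesis using p quad_setI quad_add by metis
  qed
qed

text \<open>An element of \<open>H\<close> outside the ring is congruent to \<omega>, so \<omega>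
  lies in \<open>H\<close>. As \<omega>^2 = \<omega> + (d - 1)/4 with d = 1 modulo 4,
  \<open>H\<close> is then all of Z[\<omega>].\<close>

lemma half_root_mult_closed:
  assumes "\<not> H \<subseteq> quad_set d" "q \<in> H"
  shows "half_root d * q \<in> H"
proof -
  let ?w = "half_root d"
  obtain h where h: "h \<in> H" "h - ?w \<in> quad_set d"
    using assms(1) quad_or_half_root by blast
  then have w: "?w \<in> H" using diff_quad[OF h] by simp
  obtain e :: int where e: "d = 1 + 4 * e"
    using d that[of "d div 4"] by auto
  have "?w * ?w = (1 + 2 * csqrt (of_int d) + csqrt (of_int d) * csqrt (of_int d)) / 4"
    unfolding half_root_def by (simp add: field_simps)
  also have "\<dots> = ?w + of_int e"
    unfolding csqrt_sq by (simp add: half_root_def e field_simps)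
  finally have ww: "?w * ?w \<in> H" using add[OF w, of "of_int e"] quad_subset by auto
  have *: "?w * r \<in> H" if "r \<in> quad_set d" for r
    using smult[OF w that] by (simp add: mult.commute)
  from quad_or_half_root[OF assms(2)] show ?thesis
  proof
    assume "q - ?w \<in> quad_set d"
    from add[OF ww *[OF this]] show ?thesis by (simp add: algebra_simps)
  qed (rule *)
qed

end

section \<open>Ideals generated by idempotent pairs\<close>

text \<open>Squared moduli of ring elements are values of the integral form a^2 - d b^2, hence
  natural numbers, and well-ordering applies.\<close>

lemma exists_minimal_modulus:
  assumes "d < 0" "I \<subseteq> quad_set d" "I \<noteq> {}"
  shows "\<exists>g\<in>I. \<forall>x\<in>I. cmod g \<le> cmod x"
proof -
  have nat: "\<exists>n::nat. (cmod x)\<^sup>2 = of_nat n" if "x \<in> quad_set d" for x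
  proof -
    obtain a b :: int where "x = of_int a + of_int b * csqrt (of_int d)"
      using \<open>x \<in> quad_set d\<close> unfolding quad_set_iff by blast
    then have "(cmod x)\<^sup>2 = of_int (a\<^sup>2 - d * b\<^sup>2)"
      using cmod_quad_sq[OF assms(1), of a b] by simp
    moreover have "a\<^sup>2 - d * b\<^sup>2 \<ge> 0"
      using assms(1) mult_nonpos_nonneg[of d "b\<^sup>2"] zero_le_power2[of a] by (smt (verit) zero_le_power2)
    ultimately have "(cmod x)\<^sup>2 = of_nat (nat (a\<^sup>2 - d * b\<^sup>2))" by simp
    then show ?thesis ..
  qed
  define f where "f x = nat \<lfloor>(cmod x)\<^sup>2\<rfloor>" for x
  have f: "(cmod x)\<^sup>2 = real (f x)" if "x \<in> quad_set d" for x
    using nat[OF that] by (auto simp: f_def)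
  obtain g where g: "g \<in> I" "\<And>x. x \<in> I \<Longrightarrow> f g \<le> f x"
    using assms(3) ex_has_least_nat[of "\<lambda>x. x \<in> I" _ f] by blast
  show ?thesis
  proof (intro bexI ballI)
    fix x assume x: "x \<in> I"
    have "(cmod g)\<^sup>2 \<le> (cmod x)\<^sup>2" using f g x assms(2) by (metis of_nat_le_iff subsetD)
    then show "cmod g \<le> cmod x" by simp
  qed (fact g)
qed

text \<open>The clause \<open>I \<noteq> {0}\<close> gives the second alternative its content: the
  zero ideal is stable under \<omega> and is also generated by the idempotent pair 0, 0.\<close>

lemma ideal_principal_or_half_root_closed:
  assumes d: "d = -3 \<or> d = -7" and I: "ideal I (sqrt_order d)"
  shows "principalideal I (sqrt_order d) \<or>
         I \<noteq> {0} \<and> (\<forall>x\<in>I. half_root d * x \<in> I)"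
proof (cases "I = {0}")
  case True
  then have "I = {r * 0 | r. r \<in> quad_set d}" using quad_0[of d] by auto
  then show ?thesis using principalideal_sqrt_orderI[OF quad_0] by blast
next
  case False
  have sub: "I \<subseteq> quad_set d" and I0: "0 \<in> I"
    and plus: "\<And>x y. x \<in> I \<Longrightarrow> y \<in> I \<Longrightarrow> x + y \<in> I"
    and scale: "\<And>x r. x \<in> I \<Longrightarrow> r \<in> quad_set d \<Longrightarrow> r * x \<in> I"
    using I unfolding ideal_sqrt_order_iff by auto
  have "d < 0" "I - {0} \<subseteq> quad_set d" "I - {0} \<noteq> {}" using sub False I0 d by auto
  from exists_minimal_modulus[OF this] obtain g
    where "g \<in> I - {0}" and min: "\<forall>x\<in>I - {0}. cmod g \<le> cmod x" ..
  then have g: "g \<in> I" "g \<noteq> 0" by auto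
  define H where "H = {q. q * g \<in> I}"
  interpret reduced_module d H
  proof
    show "1 \<le> cmod x" if "x \<in> H" "x \<noteq> 0" for x
      using min[THEN bspec, of "x * g"] that g by (simp add: H_def norm_mult)
    show "x + y \<in> H" if "x \<in> H" "y \<in> H" for x y
      using plus that by (simp add: H_def distrib_right)
    show "r * x \<in> H" if "x \<in> H" "r \<in> quad_set d" for x r
      using scale[of "x * g" r] that by (simp add: H_def mult.assoc)
  qed (use d g in \<open>auto simp: H_def\<close>)
  have div: "x / g \<in> H" if "x \<in> I" for x using that g by (simp add: H_def)
  show ?thesis
  proof (cases "H \<subseteq> quad_set d")
    case True
    have "I = {r * g | r. r \<in> quad_set d}"
    proof (intro equalityI subsetI)
      fix x assume "x \<in> I"
      then have "x / g \<in> quad_set d" "x = x / g * g" using div True g by auto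
      then show "x \<in> {r * g | r. r \<in> quad_set d}" by blast
    qed (use scale g in auto)
    then show ?thesis using principalideal_sqrt_orderI g sub by blast
  next
    case nsub: False
    have "half_root d * x \<in> I" if "x \<in> I" for x
      using half_root_mult_closed[OF nsub div[OF that]] g by (simp add: H_def)
    then show ?thesis using False by blast
  qed
qed

lemma idempotent_ideal_not_half_root_closed:
  assumes "d < 0" and ab: "a \<in> quad_set d" "b \<in> quad_set d" "c \<in> quad_set d"
    and abc: "a * (1 - a) = c * b"
    and I: "I = {u * a + v * b | u v. u \<in> quad_set d \<and> v \<in> quad_set d}" "I \<noteq> {0}"
    and closed: "\<And>x. x \<in> I \<Longrightarrow> half_root d * x \<in> I"
  shows False
proof -
  let ?w = "half_root d"
  have "a = 1 * a + 0 * b" "b = 0 * a + 1 * b" by auto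
  then have aI: "a \<in> I" and bI: "b \<in> I" unfolding I using quad_0 quad_1 by blast+
  have sub: "I \<subseteq> quad_set d" using I ab by auto
  have "?w \<in> quad_set d"
  proof (cases "b = 0")
    case True
    \<comment> \<open>If a = 1, then \<omega> = \<omega> a lies in \<open>I\<close>, hence in the
      ring; a = 0 would make \<open>I\<close> zero.\<close>
    then have "a = 0 \<or> a = 1" using abc by auto
    moreover have "a \<noteq> 0"
    proof
      assume "a = 0"
      then have "I \<subseteq> {0}" "0 \<in> I" using True I(1) aI by auto
      then show False using I(2) by auto
    qed
    ultimately show ?thesis using closed[OF aI] sub by auto
  next
    case False
    obtain u v where uv: "?w * a = u * a + v * b" "u \<in> quad_set d" "v \<in> quad_set d"
      using closed[OF aI] unfolding I by blast
    obtain u' v' where uv': "?w * b = u' * a + v' * b" "u' \<in> quad_set d" "v' \<in> quad_set d"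
      using closed[OF bI] unfolding I by blast
    \<comment> \<open>Both summands are ring multiples of b: the first because \<omega> a lies in
      the ring, the second because \<omega> b is in \<open>I\<close> and a (1 - a) = c b. Cancelling
      b puts \<omega> into the ring.\<close>
    have "?w * b = (?w * a) * b + (?w * b) * (1 - a)" by (simp add: algebra_simps)
    also have "\<dots> = (?w * a) * b + (u' * (a * (1 - a)) + v' * b * (1 - a))"
      unfolding uv'(1) by (simp add: algebra_simps)
    also have "\<dots> = (u * a + v * b + u' * c + v' * (1 - a)) * b"
      unfolding abc uv(1) by (simp add: algebra_simps)
    finally have "?w = u * a + v * b + u' * c + v' * (1 - a)" using False by simp
    then show ?thesis using uv uv' ab by auto
  qed
  then show False using half_root_not_in_quad_set[OF assms(1)] by blast
qed

lemma PRINC_domain_sqrt_order: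
  assumes d: "d = -3 \<or> d = -7"
  shows "PRINC_domain (sqrt_order d)"
proof (intro PRINC_domain.intro PRINC_domain_axioms.intro domain_sqrt_order)
  interpret R: "domain" "sqrt_order d" by (rule domain_sqrt_order)
  have d_neg: "d < 0" using d by auto
  have *: "principalideal (genideal (sqrt_order d) {a, b}) (sqrt_order d)"
    if ab: "a \<in> quad_set d" "b \<in> quad_set d" "c \<in> quad_set d" and abc: "a * (1 - a) = c * b"
    for a b c
  proof -
    have "ideal (genideal (sqrt_order d) {a, b}) (sqrt_order d)"
      using ab by (intro R.genideal_ideal) auto
    then show ?thesis
      using ideal_principal_or_half_root_closed[OF d] d_neg
        idempotent_ideal_not_half_root_closed[OF _ ab abc genideal_pair_sqrt_order[OF ab(1,2)]]
      by blast
  qed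
  fix a b assume "idempotent_pair (sqrt_order d) a b"
  then have ab: "a \<in> quad_set d" "b \<in> quad_set d"
    and or: "(\<exists>c\<in>quad_set d. a * (1 - a) = c * b) \<or> (\<exists>c\<in>quad_set d. b * (1 - b) = c * a)"
    unfolding idempotent_pair_def by (auto simp: cgenideal_def minus_sqrt_order)
  \<comment> \<open>The second alternative is the first with a and b exchanged, and both pairs
    generate the same ideal.\<close>
  then show "principalideal (genideal (sqrt_order d) {a, b}) (sqrt_order d)"
    using *[of a b] *[of b a] by (auto simp: insert_commute)
qed

theorem corollary4p5:
  shows "PRINC_domain (sqrt_order (-3)) \<and> PRINC_domain (sqrt_order (-7))"
  using PRINC_domain_sqrt_order[of "-3"] PRINC_domain_sqrt_order[of "-7"] by simp

end
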